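(* Let $G$ be a connected, locally finite, $k$-regular graph, regarded as a metric space with its path metric. Then the hyperspace $\mathcal{K}(G)$ is plastic; that is, every bijective nonexpansive map $F\colon\mathcal{K}(G)\to\mathcal{K}(G)$ is an isometry.
   Context: Graphs are simple, undirected and unweighted. A connected graph $G$ is identified with its vertex set and equipped with the path metric $d(u,v)$ = minimal length of a walk from $u$ to $v$. $G$ is locally finite if every vertex has finite degree, and $k$-regular if every vertex has degree $k$ (a finite number). For a metric space $X$, $\mathcal{K}(X)$ is the set of all nonempty compact subsets of $X$ with the Hausdorff metric $d_H(A,B)=\max\{\sup_{a\in A}d(a,B),\sup_{b\in B}d(b,A)\}$; for a graph, $\mathcal{K}(G)$ consists of the nonempty finite sets of vertices. A map $f$ is nonexpansive if $d(f(x),f(y))\le d(x,y)$ for all $x,y$. A metric space is plastic if every bijective nonexpansive self-map is an isometry. *)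

theory Defs
  imports "HOL-Analysis.Abstract_Metric_Spaces" "Graph_Theory.Graph_Theory"
begin

section \<open>Plastic metric spaces and hyperspaces\<close>

definition nonexpansive_on :: "'a set \<Rightarrow> ('a \<Rightarrow> 'a \<Rightarrow> real) \<Rightarrow> ('a \<Rightarrow> 'a) \<Rightarrow> bool" where
  "nonexpansive_on M d f \<longleftrightarrow> (\<forall>x\<in>M. \<forall>y\<in>M. d (f x) (f y) \<le> d x y)"

definition isometry_on :: "'a set \<Rightarrow> ('a \<Rightarrow> 'a \<Rightarrow> real) \<Rightarrow> ('a \<Rightarrow> 'a) \<Rightarrow> bool" where
  "isometry_on M d f \<longleftrightarrow> (\<forall>x\<in>M. \<forall>y\<in>M. d (f x) (f y) = d x y)"

definition plastic :: "'a set \<Rightarrow> ('a \<Rightarrow> 'a \<Rightarrow> real) \<Rightarrow> bool" where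
  "plastic M d \<longleftrightarrow> (\<forall>f. bij_betw f M M \<and> nonexpansive_on M d f \<longrightarrow> isometry_on M d f)"

definition hyperspace :: "'a set \<Rightarrow> ('a \<Rightarrow> 'a \<Rightarrow> real) \<Rightarrow> 'a set set" where
  "hyperspace M d = {A. compactin (Metric_space.mtopology M d) A \<and> A \<noteq> {}}"

text \<open>The real infima and suprema below are meaningful because the definition is only used for
  nonempty compact (hence bounded) sets.\<close>

definition point_set_dist :: "('a \<Rightarrow> 'a \<Rightarrow> real) \<Rightarrow> 'a \<Rightarrow> 'a set \<Rightarrow> real" where
  "point_set_dist d a B = (INF b\<in>B. d a b)"

definition hausdorff_dist :: "('a \<Rightarrow> 'a \<Rightarrow> real) \<Rightarrow> 'a set \<Rightarrow> 'a set \<Rightarrow> real" where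
  "hausdorff_dist d A B =
     max (SUP a\<in>A. point_set_dist d a B) (SUP b\<in>B. point_set_dist d b A)"


section \<open>Simple graphs and the path metric\<close>

text \<open>An undirected edge is represented by its two opposite arcs. This is the locale
  \<^locale>\<open>graph\<close> without finiteness.\<close>

locale simple_graph = loopfree_digraph G + nomulti_digraph G + sym_digraph G
  for G :: "('a, 'b) pre_digraph" (structure)

text \<open>There are neither loops nor parallel arcs, so the arcs leaving \<open>v\<close> are in bijection with
  the neighbours of \<open>v\<close> and \<^const>\<open>out_degree\<close> is the undirected degree. As \<^const>\<open>out_degree\<close>
  is \<open>0\<close> for infinitely many arcs, finiteness is demanded explicitly.\<close>

definition locally_finite :: "('a, 'b) pre_digraph \<Rightarrow> bool" where
  "locally_finite G \<longleftrightarrow> (\<forall>v\<in>verts G. finite (out_arcs G v))"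

definition regular_graph :: "nat \<Rightarrow> ('a, 'b) pre_digraph \<Rightarrow> bool" where
  "regular_graph k G \<longleftrightarrow> (\<forall>v\<in>verts G. finite (out_arcs G v) \<and> out_degree G v = k)"

definition path_dist :: "('a, 'b) pre_digraph \<Rightarrow> 'a \<Rightarrow> 'a \<Rightarrow> real" where
  "path_dist G u v = real (LEAST n. \<exists>p. pre_digraph.awalk G u p v \<and> length p = n)"

lemma (in wf_digraph) path_dist_le:
  assumes "awalk u p v"
  shows "path_dist G u v \<le> length p"
  unfolding path_dist_def using assms by (auto intro: Least_le)

lemma (in wf_digraph) path_dist_attained:
  assumes "u \<rightarrow>\<^sup>*\<^bsub>G\<^esub> v"
  obtains p where "awalk u p v" "path_dist G u v = length p"
proof -
  from assms obtain q where "awalk u q v"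
    by (auto simp: reachable_awalk)
  then have "\<exists>n p. awalk u p v \<and> length p = n"
    by blast
  from LeastI_ex[OF this] show ?thesis
    using that unfolding path_dist_def by auto
qed

lemma (in sym_digraph) awalk_reverse:
  assumes "awalk u p v"
  shows "\<exists>q. awalk v q u \<and> length q = length p"
  using assms
proof (induction p arbitrary: u)
  case Nil
  then show ?case by (auto simp: awalk_Nil_iff)
next
  case (Cons e p)
  then have e: "e \<in> arcs G" "tail G e = u" and "awalk (head G e) p v"
    by (auto simp: awalk_Cons_iff)
  with Cons.IH obtain q where q: "awalk v q (head G e)" "length q = length p"
    by blast
  from e sym_arcs obtain e' where e': "e' \<in> arcs G" "tail G e' = head G e" "head G e' = u"
    unfolding symmetric_conv by metis
  then have "awalk (head G e) [e'] u"
    by (auto simp: awalk_Cons_iff awalk_Nil_iff)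
  from awalk_appendI[OF q(1) this] q(2) show ?case
    by (intro exI[of _ "q @ [e']"]) simp
qed

lemma (in sym_digraph) path_dist_commute: "path_dist G u v = path_dist G v u"
proof -
  have "(\<exists>p. awalk u p v \<and> length p = n) \<longleftrightarrow> (\<exists>p. awalk v p u \<and> length p = n)" for n
    using awalk_reverse by blast
  then show ?thesis
    unfolding path_dist_def by simp
qed

lemma (in sym_digraph) connected_reachable:
  assumes "Digraph_Component.connected G" "u \<in> verts G" "v \<in> verts G"
  shows "u \<rightarrow>\<^sup>*\<^bsub>G\<^esub> v"
  using symmetric_connected_imp_strongly_connected[OF sym_arcs assms(1)] assms(2,3)
  by (auto simp: strongly_connected_def)

lemma (in sym_digraph) Metric_space_path_dist:
  assumes conn: "Digraph_Component.connected G"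
  shows "Metric_space (verts G) (path_dist G)"
proof
  fix u v
  show "0 \<le> path_dist G u v" by (simp add: path_dist_def)
  show "path_dist G u v = path_dist G v u" by (rule path_dist_commute)
next
  fix u v assume uv: "u \<in> verts G" "v \<in> verts G"
  obtain p where p: "awalk u p v" "path_dist G u v = length p"
    using path_dist_attained connected_reachable[OF conn uv] by blast
  show "path_dist G u v = 0 \<longleftrightarrow> u = v"
  proof
    assume "path_dist G u v = 0"
    with p show "u = v" by (simp add: awalk_Nil_iff)
  next
    assume "u = v"
    with uv have "awalk u [] v" by (simp add: awalk_Nil_iff)
    from path_dist_le[OF this] p(2) show "path_dist G u v = 0" by simp
  qed
next
  fix u v w assume *: "u \<in> verts G" "v \<in> verts G" "w \<in> verts G"
  obtain p where p: "awalk u p v" "path_dist G u v = length p"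
    using path_dist_attained connected_reachable[OF conn *(1,2)] by blast
  obtain q where q: "awalk v q w" "path_dist G v w = length q"
    using path_dist_attained connected_reachable[OF conn *(2,3)] by blast
  show "path_dist G u w \<le> path_dist G u v + path_dist G v w"
    using path_dist_le[OF awalk_appendI[OF p(1) q(1)]] p(2) q(2) by simp
qed

text \<open>The path metric is discrete, so compact sets are exactly the finite ones.\<close>

lemma (in sym_digraph) hyperspace_path_dist:
  assumes conn: "Digraph_Component.connected G"
  shows "hyperspace (verts G) (path_dist G) = {A. A \<subseteq> verts G \<and> finite A \<and> A \<noteq> {}}"
proof -
  interpret M: Metric_space "verts G" "path_dist G"
    by (rule Metric_space_path_dist[OF conn])
  have *: "M.mtopology = discrete_topology (verts G)"
  proof -
    have "openin M.mtopology {v}" if "v \<in> verts G" for v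
    proof -
      have "path_dist G v w < 1 \<longleftrightarrow> w = v" if "w \<in> verts G" for w
      proof -
        have "path_dist G v w < 1 \<longleftrightarrow> path_dist G v w = 0"
          by (auto simp: path_dist_def)
        with \<open>v \<in> verts G\<close> that show ?thesis by auto
      qed
      with that have "M.mball v 1 = {v}" by (auto simp: M.mball_def)
      with M.openin_mball[of v 1] show ?thesis by simp
    qed
    then show ?thesis
      using discrete_topology_unique[of "verts G" M.mtopology] by auto
  qed
  show ?thesis
    unfolding hyperspace_def * by (auto simp: compactin_discrete_topology)
qed

end

theory Submission
  imports Defs
begin

text \<open>
  Why the theorem holds. Let \<open>N v\<close> be the closed neighbourhood of \<open>v\<close>, a set of \<open>k + 1\<close> vertices,
  let \<open>K\<close> be the set of nonempty finite sets of vertices, and let \<open>F\<close> be a nonexpansive bijection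
  of \<open>K\<close>. On a \<^emph>\<open>finite\<close> metric space a nonexpansive bijection is an isometry, because a
  relation \<open>d(x, y) \<le> r\<close> has finitely many pairs, which the bijection permutes
  (\<open>finite_relation_reflected\<close>). It would therefore suffice that \<open>F\<close> fixes a singleton \<open>{v}\<close>: then
  \<open>F\<close> maps every ball around \<open>{v}\<close> into itself, these balls are finite, and they exhaust \<open>K\<close>. In
  general \<open>F\<close> may move everything and it may also mix singletons with larger sets, but only in a
  way that an automorphism of the graph can undo.

  Unit balls in \<open>K\<close> show this. Call vertices with the same closed neighbourhood twins. Every
  \<open>A \<in> K\<close> has at least \<open>2^(k+1) - 1\<close> sets within distance 1, and equality holds only if the members
  of \<open>A\<close> are twins of each other; in that case these sets are the nonempty subsets of \<open>N a\<close>,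
  \<open>a \<in> A\<close> (\<open>card_unit_ball_ge\<close>, \<open>card_unit_ball_gt\<close>, \<open>unit_ball_twin_set\<close>). As \<open>F\<close> injects the unit
  ball of \<open>B\<close> into that of \<open>F B\<close>, the preimage of a set of twins is a set of twins, and the unit
  balls correspond exactly. Hence, if \<open>h v\<close> is any vertex of the set that \<open>F\<close> maps to \<open>{v}\<close>,
  \<open>A \<subseteq> N (h v)\<close> is equivalent to \<open>F A \<subseteq> N v\<close> for all \<open>A \<in> K\<close>. This makes \<open>h\<close> preserve and reflect
  neighbourhood and twinship, and shows that the class of twins of \<open>h v\<close> is at least as large as
  that of \<open>v\<close>. Injections between these classes turn \<open>h\<close> into an injective map \<open>g\<close> with \<open>g v\<close> a twin
  of \<open>h v\<close>. By regularity \<open>g\<close> maps \<open>N v\<close> onto \<open>N (g v)\<close>, so its image is closed under neighbours,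
  and connectedness makes \<open>g\<close> an automorphism (\<open>ex_automorphism\<close>).

  Finally, \<open>A \<mapsto> F (g ` A)\<close> is a nonexpansive bijection that maps some set \<open>B\<close> of twins of \<open>v\<close> to
  \<open>{v}\<close>. Twins have the same balls of every radius \<open>n \<ge> 1\<close>, so the sets within distance \<open>n\<close> of \<open>B\<close>
  and of \<open>{v}\<close> coincide: both are the nonempty subsets of the ball of radius \<open>n\<close> around \<open>v\<close>. The
  finite argument applies to them (\<open>near_reflect\<close>), and \<open>g\<close> acts on \<open>K\<close> as an isometry.
\<close>

section \<open>Hausdorff distance of finite sets\<close>

text \<open>For finite sets this is Hausdorff distance at most \<open>r\<close>, free of suprema and infima.\<close>

definition near :: "('a \<Rightarrow> 'a \<Rightarrow> real) \<Rightarrow> real \<Rightarrow> 'a set \<Rightarrow> 'a set \<Rightarrow> bool" where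
  "near d r A B \<longleftrightarrow> (\<forall>a\<in>A. \<exists>b\<in>B. d a b \<le> r) \<and> (\<forall>b\<in>B. \<exists>a\<in>A. d b a \<le> r)"

lemma point_set_dist_le_iff:
  assumes "finite B" "B \<noteq> {}"
  shows "point_set_dist d a B \<le> r \<longleftrightarrow> (\<exists>b\<in>B. d a b \<le> r)"
  using assms unfolding point_set_dist_def
  by (subst cInf_eq_Min) (auto simp: Min_le_iff)

lemma hausdorff_dist_le_iff_near:
  assumes "finite A" "A \<noteq> {}" "finite B" "B \<noteq> {}"
  shows "hausdorff_dist d A B \<le> r \<longleftrightarrow> near d r A B"
  using assms unfolding hausdorff_dist_def near_def
  by (simp add: cSup_eq_Max point_set_dist_le_iff)

text \<open>The induced map on pairs is injective and maps the finite set of related pairs into itself,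
  hence onto itself.\<close>

lemma finite_relation_reflected:
  assumes fin: "finite X" and inj: "inj_on f X" and into: "f ` X \<subseteq> X"
    and preserved: "\<And>x y. x \<in> X \<Longrightarrow> y \<in> X \<Longrightarrow> R x y \<Longrightarrow> R (f x) (f y)"
    and xy: "x \<in> X" "y \<in> X" "R (f x) (f y)"
  shows "R x y"
proof -
  define P where "P = {(u, v). u \<in> X \<and> v \<in> X \<and> R u v}"
  have "finite P" using fin by (intro finite_subset[of P "X \<times> X"]) (auto simp: P_def)
  moreover have "map_prod f f ` P \<subseteq> P" using into preserved unfolding P_def by auto
  moreover have "inj_on (map_prod f f) P"
    by (rule inj_on_subset[OF map_prod_inj_on[OF inj inj]]) (auto simp: P_def)
  ultimately have "map_prod f f ` P = P" by (rule endo_inj_surj)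
  moreover have "(f x, f y) \<in> P" using xy into unfolding P_def by auto
  ultimately obtain u v where "(u, v) \<in> P" "f u = f x" "f v = f y" by force
  then show ?thesis using xy(1,2) inj unfolding P_def inj_on_def by blast
qed

section \<open>Path metrics of regular graphs\<close>

text \<open>What is used of the path metric of a connected \<open>k\<close>-regular graph: it is integer valued, one
  can approach any vertex in steps of length 1, and closed balls of radius 1, which contain their
  centre, have \<open>k + 1\<close> elements. As \<open>k + 1\<close> is positive, the last condition includes their
  finiteness.\<close>

locale regular_graph_metric = Metric_space V d for V :: "'a set" and d +
  fixes k :: nat
  assumes dist_in_Nats: "u \<in> V \<Longrightarrow> v \<in> V \<Longrightarrow> d u v \<in> \<nat>"
    and geodesic_step:
      "u \<in> V \<Longrightarrow> v \<in> V \<Longrightarrow> d u v \<le> real (Suc n) \<Longrightarrow> \<exists>w\<in>V. d u w \<le> 1 \<and> d w v \<le> real n"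
    and card_nbhd: "v \<in> V \<Longrightarrow> card (mcball v 1) = Suc k"
begin

abbreviation N :: "'a \<Rightarrow> 'a set" where
  "N v \<equiv> mcball v 1"

abbreviation K :: "'a set set" where
  "K \<equiv> {A. A \<subseteq> V \<and> finite A \<and> A \<noteq> {}}"

lemma finite_nbhd: "finite (N v)"
proof (cases "v \<in> V")
  case True
  then show ?thesis using card_nbhd[of v] card.infinite by fastforce
next
  case False
  then show ?thesis by (simp add: mcball_def)
qed

lemma nbhd_commute: "u \<in> N v \<longleftrightarrow> v \<in> N u"
  by (auto simp: commute)

lemma nbhd_refl: "v \<in> V \<Longrightarrow> v \<in> N v"
  by simp

lemma nbhd_subset_imp_eq:
  assumes "u \<in> V" "v \<in> V" "N u \<subseteq> N v"
  shows "N u = N v"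
  using assms by (intro card_subset_eq finite_nbhd) (auto simp: card_nbhd)

lemma card_nonempty_subsets_nbhd:
  assumes "u \<in> V" "v \<in> V"
  shows "card (Pow (N u) - {{}}) = card (Pow (N v) - {{}})"
  using assms by (simp add: card_Diff_singleton finite_nbhd card_Pow card_nbhd)

text \<open>Connectedness: a vertex at distance \<open>n\<close> from the set is reached from it in \<open>n\<close> steps.\<close>

lemma nbhd_closed_is_everything:
  assumes "x \<in> S" "S \<subseteq> V" and closed: "\<And>y. y \<in> S \<Longrightarrow> N y \<subseteq> S"
  shows "S = V"
proof -
  have "u \<in> S" if "y \<in> S" "u \<in> V" "d y u \<le> real n" for y u n
    using that
  proof (induction n arbitrary: y)
    case 0
    then have "y = u" using assms(2) zero[of y u] nonneg[of y u] by auto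
    with 0 show ?case by simp
  next
    case (Suc n)
    then obtain w where w: "w \<in> V" "d y w \<le> 1" "d w u \<le> real n"
      using geodesic_step[of y u n] assms(2) by blast
    then have "w \<in> N y" using Suc.prems(1) assms(2) by auto
    then have "w \<in> S" using closed[OF Suc.prems(1)] by blast
    with Suc w show ?case by blast
  qed
  then show ?thesis using assms(1,2) real_arch_simple by blast
qed

lemma finite_mcball: "finite (mcball v (real n))"
proof (induction n arbitrary: v)
  case 0
  have "mcball v (real 0) \<subseteq> {v}" using nonneg by (auto simp: order_antisym_conv)
  then show ?case using finite_subset by blast
next
  case (Suc n)
  have "mcball v (real (Suc n)) \<subseteq> (\<Union>w\<in>N v. mcball w (real n))"
  proof
    fix u assume "u \<in> mcball v (real (Suc n))"
    then have "v \<in> V" "u \<in> V" "d v u \<le> real (Suc n)" by auto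
    then obtain w where "w \<in> V" "d v w \<le> 1" "d w u \<le> real n"
      using geodesic_step by blast
    then show "u \<in> (\<Union>w\<in>N v. mcball w (real n))"
      using \<open>v \<in> V\<close> \<open>u \<in> V\<close> by auto
  qed
  then show ?case using finite_subset finite_nbhd Suc by blast
qed

text \<open>A shortest path from \<open>u\<close> to another vertex starts with a step to some member of
  \<open>N u = N v\<close>, so it can be rerouted to start at \<open>v\<close>. For radius 0 this fails, as twins are distinct
  in general.\<close>

lemma twins_mcball:
  assumes "u \<in> V" "v \<in> V" "N u = N v" "n \<ge> 1"
  shows "mcball u (real n) = mcball v (real n)"
proof -
  have *: "mcball x (real n) \<subseteq> mcball y (real n)" if "x \<in> V" "y \<in> V" "N x = N y" for x y
  proof
    fix z assume z: "z \<in> mcball x (real n)"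
    obtain m where m: "n = Suc m" using assms(4) by (cases n) auto
    obtain w where w: "w \<in> V" "d x w \<le> 1" "d w z \<le> real m"
      using geodesic_step[of x z m] z m by auto
    then have "w \<in> N y" using that by auto
    then show "z \<in> mcball y (real n)"
      using w z m triangle[of y w z] by auto
  qed
  show ?thesis using *[of u v] *[of v u] assms by blast
qed

section \<open>Unit balls of the hyperspace\<close>

definition twin_class :: "'a \<Rightarrow> 'a set" where
  "twin_class v = {u\<in>V. N u = N v}"

definition twin_set :: "'a set \<Rightarrow> bool" where
  "twin_set A \<longleftrightarrow> (\<forall>a\<in>A. \<forall>b\<in>A. N a = N b)"

definition unit_ball :: "'a set \<Rightarrow> 'a set set" where
  "unit_ball A = {B\<in>K. near d 1 A B}"

lemma mem_unit_ball_iff: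
  assumes "A \<in> K"
  shows "B \<in> unit_ball A \<longleftrightarrow> B \<subseteq> (\<Union>a\<in>A. N a) \<and> (\<forall>a\<in>A. N a \<inter> B \<noteq> {})"
proof (cases "B \<subseteq> V")
  case True
  have A: "A \<subseteq> V" "A \<noteq> {}" using assms by auto
  have "near d 1 A B \<longleftrightarrow> (\<forall>a\<in>A. \<exists>b\<in>B. b \<in> N a) \<and> (\<forall>b\<in>B. \<exists>a\<in>A. b \<in> N a)"
    using A(1) True unfolding near_def by (simp add: commute subset_iff)
  also have "\<dots> \<longleftrightarrow> B \<subseteq> (\<Union>a\<in>A. N a) \<and> (\<forall>a\<in>A. N a \<inter> B \<noteq> {})"
    by blast
  finally have *: "near d 1 A B \<longleftrightarrow> \<dots>" .
  have "finite (\<Union>a\<in>A. N a)" using assms finite_nbhd by blast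
  then have "finite B \<and> B \<noteq> {}" if "near d 1 A B"
    using that A(2) finite_subset[of B] unfolding * by fastforce
  then have "B \<in> unit_ball A \<longleftrightarrow> near d 1 A B" using True unfolding unit_ball_def by auto
  then show ?thesis by (simp only: *)
next
  case False
  moreover have "(\<Union>a\<in>A. N a) \<subseteq> V" using mcball_subset_mspace by blast
  ultimately have "\<not> B \<subseteq> (\<Union>a\<in>A. N a)" by (meson order_trans)
  with False show ?thesis unfolding unit_ball_def by simp
qed

lemma finite_unit_ball: "A \<in> K \<Longrightarrow> finite (unit_ball A)"
  using finite_nbhd mem_unit_ball_iff
  by (intro finite_subset[of "unit_ball A" "Pow (\<Union>a\<in>A. N a)"] subsetI)
    (simp_all del: in_mcball)

lemma unit_ball_twin_set:
  assumes "A \<in> K" "twin_set A" "a \<in> A"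
  shows "unit_ball A = Pow (N a) - {{}}"
proof -
  have "N b = N a" if "b \<in> A" for b using assms that unfolding twin_set_def by blast
  then have "(\<Union>b\<in>A. N b) = N a" and "(\<forall>b\<in>A. N b \<inter> B \<noteq> {}) \<longleftrightarrow> N a \<inter> B \<noteq> {}" for B
    using assms(3) by blast+
  then have "B \<in> unit_ball A \<longleftrightarrow> B \<subseteq> N a \<and> N a \<inter> B \<noteq> {}" for B
    by (simp only: mem_unit_ball_iff[OF assms(1)])
  then show ?thesis by blast
qed

text \<open>Adding the fixed set \<open>(\<Union>x\<in>A. N x) - N a\<close> turns any nonempty \<open>S \<subseteq> N a\<close> into a set within
  distance 1 of \<open>A\<close>: for \<open>b \<in> A\<close>, either some member of \<open>N b\<close> lies outside \<open>N a\<close>, and that vertex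
  was added, or \<open>N b \<subseteq> N a\<close>; then regularity gives \<open>N b = N a\<close>, and \<open>S\<close> itself is close to
  \<open>b\<close>. Intersecting with \<open>N a\<close> recovers \<open>S\<close>.\<close>

lemma unit_ball_extension:
  assumes A: "A \<in> K" and a: "a \<in> A"
  defines "\<Phi> \<equiv> \<lambda>S. S \<union> ((\<Union>x\<in>A. N x) - N a)"
  shows "inj_on \<Phi> (Pow (N a) - {{}})" "\<Phi> ` (Pow (N a) - {{}}) \<subseteq> unit_ball A"
proof -
  have "\<Phi> S \<inter> N a = S" if "S \<subseteq> N a" for S using that unfolding \<Phi>_def by auto
  then show "inj_on \<Phi> (Pow (N a) - {{}})"
    by (metis DiffD1 PowD inj_onI)
  have "\<Phi> S \<in> unit_ball A" if S: "S \<subseteq> N a" "S \<noteq> {}" for S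
    unfolding mem_unit_ball_iff[OF A]
  proof (intro conjI ballI)
    show "\<Phi> S \<subseteq> (\<Union>x\<in>A. N x)" using S a unfolding \<Phi>_def by blast
    fix b assume b: "b \<in> A"
    show "N b \<inter> \<Phi> S \<noteq> {}"
    proof (cases "N b \<subseteq> N a")
      case True
      then have "N b = N a" using nbhd_subset_imp_eq A a b by blast
      then show ?thesis using S unfolding \<Phi>_def by blast
    next
      case False
      then show ?thesis using b unfolding \<Phi>_def by blast
    qed
  qed
  then show "\<Phi> ` (Pow (N a) - {{}}) \<subseteq> unit_ball A" by blast
qed

lemma card_unit_ball_ge:
  assumes "A \<in> K" "a \<in> A"
  shows "card (Pow (N a) - {{}}) \<le> card (unit_ball A)"
  using unit_ball_extension[OF assms] finite_unit_ball[OF assms(1)] card_inj_on_le by blast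

text \<open>If \<open>b \<in> A\<close> is not a twin of \<open>a\<close>, some \<open>w \<in> N b\<close> lies outside \<open>N a\<close>. All sets built in
  \<open>unit_ball_extension\<close> contain \<open>w\<close>, whereas \<open>(\<Union>x\<in>A. N x) - {w}\<close> is a further set within distance 1
  of \<open>A\<close>. The latter needs that no \<open>N x\<close> is contained in \<open>{w}\<close>, that is, \<open>k \<noteq> 0\<close>; a connected graph
  with \<open>k = 0\<close> has a single vertex, so it has no pair of non-twins.\<close>

lemma card_unit_ball_gt:
  assumes A: "A \<in> K" and "\<not> twin_set A"
  obtains a where "a \<in> A" "card (Pow (N a) - {{}}) < card (unit_ball A)"
proof -
  obtain a b where ab: "a \<in> A" "b \<in> A" "N b \<noteq> N a"
    using assms(2) unfolding twin_set_def by blast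
  define \<Phi> where "\<Phi> = (\<lambda>S. S \<union> ((\<Union>x\<in>A. N x) - N a))"
  note \<Phi> = unit_ball_extension[OF A ab(1), folded \<Phi>_def]
  have "\<not> N b \<subseteq> N a" using nbhd_subset_imp_eq[of b a] ab A by blast
  then obtain w where w: "w \<in> N b" "w \<notin> N a" by blast
  have "\<not> N x \<subseteq> {w}" if x: "x \<in> A" for x
  proof
    assume "N x \<subseteq> {w}"
    then have "card (N x) \<le> card {w}" by (intro card_mono) auto
    \<comment> \<open>Then \<open>a\<close> is isolated and hence the only vertex.\<close>
    then have "k = 0" using card_nbhd x A by auto
    then have "card (N a) = 1" using card_nbhd ab A by auto
    then obtain z where "N a = {z}" by (rule card_1_singletonE)
    moreover have "a \<in> N a" using nbhd_refl ab A by blast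
    ultimately have "N a = {a}" by blast
    then have "{a} = V" using nbhd_closed_is_everything[of a "{a}"] ab A by blast
    then have "a = b" using ab A by blast
    then show False using ab by simp
  qed
  then have "\<forall>x\<in>A. N x \<inter> ((\<Union>x\<in>A. N x) - {w}) \<noteq> {}" by blast
  then have "(\<Union>x\<in>A. N x) - {w} \<in> unit_ball A"
    unfolding mem_unit_ball_iff[OF A] by blast
  moreover have "(\<Union>x\<in>A. N x) - {w} \<notin> \<Phi> ` (Pow (N a) - {{}})"
    using w ab unfolding \<Phi>_def by blast
  ultimately have "\<Phi> ` (Pow (N a) - {{}}) \<subset> unit_ball A" using \<Phi>(2) by blast
  then have "card (\<Phi> ` (Pow (N a) - {{}})) < card (unit_ball A)"
    by (rule psubset_card_mono[OF finite_unit_ball[OF A]])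
  then show ?thesis unfolding card_image[OF \<Phi>(1)] by (rule that[OF ab(1)])
qed

section \<open>Graph automorphisms are isometries\<close>

lemma nbhd_preserving_map_nonexpansive:
  assumes "g ` V \<subseteq> V" and step: "\<And>v. v \<in> V \<Longrightarrow> g ` N v \<subseteq> N (g v)"
    and "u \<in> V" "v \<in> V" "d u v \<le> real n"
  shows "d (g u) (g v) \<le> real n"
  using assms(3-)
proof (induction n arbitrary: u)
  case 0
  then have "u = v" using nonneg[of u v] zero by auto
  then show ?case using 0 assms(1) by auto
next
  case (Suc n)
  then obtain w where w: "w \<in> V" "d u w \<le> 1" "d w v \<le> real n"
    using geodesic_step by blast
  then have "g w \<in> N (g u)" using Suc.prems step by force
  moreover have "d (g w) (g v) \<le> real n" using Suc w by blast
  moreover have "g v \<in> V" using assms(1) Suc.prems by blast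
  ultimately show ?case using triangle[of "g u" "g w" "g v"] by auto
qed

lemma nbhd_isomorphism_is_isometry:
  assumes g: "bij_betw g V V" and nbhd: "\<And>v. v \<in> V \<Longrightarrow> g ` N v = N (g v)"
    and uv: "u \<in> V" "v \<in> V"
  shows "d (g u) (g v) = d u v"
proof -
  define g' where "g' = the_inv_into V g"
  have g': "bij_betw g' V V" "\<And>x. x \<in> V \<Longrightarrow> g' (g x) = x" "\<And>x. x \<in> V \<Longrightarrow> g (g' x) = x"
    using g bij_betw_the_inv_into[OF g] unfolding g'_def
    by (auto simp: bij_betw_def the_inv_into_f_f f_the_inv_into_f)
  have "g' ` N v \<subseteq> N (g' v)" if "v \<in> V" for v
  proof -
    have *: "g' v \<in> V" using bij_betwE[OF g'(1)] that by simp
    have "g' ` N v = g' ` g ` N (g' v)" using nbhd[OF *] g' that by simp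
    also have "\<dots> = (\<lambda>x. x) ` N (g' v)"
      unfolding image_image using g'(2) by (intro image_cong) auto
    finally show ?thesis by simp
  qed
  then have inv_le: "d (g' x) (g' y) \<le> real n" if "x \<in> V" "y \<in> V" "d x y \<le> real n" for x y n
    using nbhd_preserving_map_nonexpansive[of g'] bij_betw_imp_surj_on[OF g'(1)] that by simp
  have le: "d (g x) (g y) \<le> real n" if "x \<in> V" "y \<in> V" "d x y \<le> real n" for x y n
    using nbhd_preserving_map_nonexpansive[of g] bij_betw_imp_surj_on[OF g] that nbhd by simp
  have gV: "g u \<in> V" "g v \<in> V" using bij_betwE[OF g] uv by simp_all
  obtain m n where "d u v = real m" "d (g u) (g v) = real n"
    using dist_in_Nats uv gV by (metis Nats_cases)
  then show ?thesis using inv_le[of "g u" "g v" n] le[of u v m] gV uv g' by simp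
qed

end

section \<open>Nonexpansive bijections of the hyperspace\<close>

locale hyperspace_bijection = regular_graph_metric V d k for V :: "'a set" and d k +
  fixes F :: "'a set \<Rightarrow> 'a set"
  assumes bij: "bij_betw F K K"
    and near_image: "A \<in> K \<Longrightarrow> B \<in> K \<Longrightarrow> near d r A B \<Longrightarrow> near d r (F A) (F B)"
begin

lemma F_in: "A \<in> K \<Longrightarrow> F A \<in> K"
  by (rule bij_betwE[OF bij, rule_format])

lemma F_surj:
  assumes "B \<in> K" obtains A where "A \<in> K" "F A = B"
proof -
  have "B \<in> F ` K" using assms bij_betw_imp_surj_on[OF bij] by simp
  then obtain A where "B = F A" "A \<in> K" by (rule imageE)
  then show ?thesis using that[of A] by simp
qed

lemma inj_on_F: "S \<subseteq> K \<Longrightarrow> inj_on F S"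
  by (rule inj_on_subset[OF bij_betw_imp_inj_on[OF bij]])

lemma F_unit_ball_subset:
  assumes A: "A \<in> K"
  shows "F ` unit_ball A \<subseteq> unit_ball (F A)"
proof (rule image_subsetI)
  fix B assume "B \<in> unit_ball A"
  then have B: "B \<in> K" "near d 1 A B" unfolding unit_ball_def by simp_all
  show "F B \<in> unit_ball (F A)"
    using F_in[OF B(1)] near_image[OF A B] unfolding unit_ball_def by simp
qed

text \<open>Sets of twins have the unit balls of least size, and \<open>F\<close> injects the unit ball of \<open>B\<close> into
  that of \<open>F B\<close>. So the unit ball of \<open>B\<close> has least size as well, and the injection is onto.\<close>

lemma preimage_of_twin_set:
  assumes B: "B \<in> K" and twin: "twin_set (F B)"
  shows "twin_set B" and "F ` unit_ball B = unit_ball (F B)"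
proof -
  have FB: "F B \<in> K" by (rule F_in[OF B])
  obtain c where c: "c \<in> F B" using FB by blast
  have inj: "inj_on F (unit_ball B)" by (intro inj_on_F) (auto simp: unit_ball_def)
  have fin: "finite (unit_ball (F B))" by (rule finite_unit_ball[OF FB])
  have le: "card (unit_ball B) \<le> card (unit_ball (F B))"
    using card_inj_on_le[OF inj F_unit_ball_subset[OF B] fin] .
  have eq: "card (unit_ball (F B)) = card (Pow (N b) - {{}})" if "b \<in> B" for b
  proof -
    have "b \<in> V" "c \<in> V" using that B c FB by auto
    then show ?thesis
      unfolding unit_ball_twin_set[OF FB twin c] by (intro card_nonempty_subsets_nbhd)
  qed
  show "twin_set B"
  proof (rule ccontr)
    assume "\<not> twin_set B"
    then obtain b where b: "b \<in> B" "card (Pow (N b) - {{}}) < card (unit_ball B)"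
      by (rule card_unit_ball_gt[OF B])
    show False using le b(2) unfolding eq[OF b(1)] by linarith
  qed
  obtain b where b: "b \<in> B" using B by blast
  have "card (unit_ball (F B)) \<le> card (F ` unit_ball B)"
    unfolding eq[OF b] card_image[OF inj] by (rule card_unit_ball_ge[OF B b])
  then show "F ` unit_ball B = unit_ball (F B)"
    by (rule card_seteq[OF fin F_unit_ball_subset[OF B]])
qed

text \<open>The unit balls of \<open>B\<close> and \<open>F B\<close>, which correspond under \<open>F\<close>, are the nonempty subsets of
  \<open>N x\<close> and of \<open>N c\<close>.\<close>

lemma subset_nbhd_iff:
  assumes B: "B \<in> K" "twin_set (F B)" and x: "x \<in> B" and c: "c \<in> F B" and A: "A \<in> K"
  shows "A \<subseteq> N x \<longleftrightarrow> F A \<subseteq> N c"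
proof -
  have 1: "unit_ball B = Pow (N x) - {{}}"
    by (rule unit_ball_twin_set[OF B(1) preimage_of_twin_set(1)[OF B] x])
  have 2: "unit_ball (F B) = Pow (N c) - {{}}"
    by (rule unit_ball_twin_set[OF F_in[OF B(1)] B(2) c])
  have "A \<in> unit_ball B \<longleftrightarrow> F A \<in> F ` unit_ball B"
    by (rule inj_on_image_mem_iff[OF inj_on_F[OF subset_refl] A, symmetric])
      (simp only: unit_ball_def Collect_restrict)
  then have "A \<in> unit_ball B \<longleftrightarrow> F A \<in> unit_ball (F B)"
    by (simp only: preimage_of_twin_set(2)[OF B])
  moreover have "A \<noteq> {}" "F A \<noteq> {}" using A F_in[OF A] by simp_all
  ultimately show ?thesis unfolding 1 2 by simp
qed

text \<open>A vertex of the set that \<open>F\<close> maps to \<open>{v}\<close>. The members of this set are twins of each other, so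
  the neighbourhood of the chosen vertex does not depend on the choice. The map need not be
  injective.\<close>

definition preimage_point :: "'a \<Rightarrow> 'a" where
  "preimage_point v = (SOME x. \<exists>B\<in>K. F B = {v} \<and> x \<in> B)"

lemma preimage_point:
  assumes "v \<in> V"
  obtains B where "B \<in> K" "F B = {v}" "preimage_point v \<in> B" "twin_set B"
proof -
  have "{v} \<in> K" using assms by simp
  then obtain B where B: "B \<in> K" "F B = {v}" by (rule F_surj)
  then obtain x where "x \<in> B" by blast
  with B have "F B = {v} \<and> x \<in> B" by simp
  then have "\<exists>B\<in>K. F B = {v} \<and> x \<in> B" using B(1) by (rule bexI)
  then have "\<exists>x. \<exists>B\<in>K. F B = {v} \<and> x \<in> B" by (rule exI)
  from someI_ex[OF this, folded preimage_point_def]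
  obtain B where B: "B \<in> K" "F B = {v}" "preimage_point v \<in> B" by (elim bexE conjE)
  moreover have "twin_set (F B)" unfolding B(2) twin_set_def by simp
  then have "twin_set B" by (rule preimage_of_twin_set(1)[OF B(1)])
  ultimately show ?thesis by (rule that)
qed

lemma preimage_point_in:
  assumes "v \<in> V"
  shows "preimage_point v \<in> V"
  using assms by (rule preimage_point) auto

lemma subset_nbhd_preimage_point_iff:
  assumes "v \<in> V" "A \<in> K"
  shows "A \<subseteq> N (preimage_point v) \<longleftrightarrow> F A \<subseteq> N v"
  using assms(1)
proof (rule preimage_point)
  fix B assume B: "B \<in> K" "F B = {v}" "preimage_point v \<in> B"
  show ?thesis
    by (rule subset_nbhd_iff[OF B(1) _ B(3) _ assms(2)]) (simp_all add: B(2) twin_set_def)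
qed

lemma nbhd_eqI:
  assumes "x \<in> V" "y \<in> V" "\<And>A. A \<in> K \<Longrightarrow> A \<subseteq> N x \<longleftrightarrow> A \<subseteq> N y"
  shows "N x = N y"
proof -
  have "u \<in> N x \<longleftrightarrow> u \<in> N y" if "u \<in> V" for u using assms(3)[of "{u}"] that by simp
  then show ?thesis by auto
qed

text \<open>For \<open>x \<in> B\<close> and \<open>c \<in> F B\<close>, both \<open>A \<subseteq> N x\<close> and \<open>A \<subseteq> N (preimage_point v)\<close> say that
  \<open>F A \<subseteq> N c = N v\<close>. Singletons \<open>A\<close> then show that \<open>x\<close> and \<open>preimage_point v\<close> are twins.\<close>

lemma preimage_in_twin_class:
  assumes v: "v \<in> V" and B: "B \<in> K" "F B \<subseteq> twin_class v"
  shows "B \<subseteq> twin_class (preimage_point v)"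
proof
  fix x assume x: "x \<in> B"
  have twins: "N a = N v" if "a \<in> F B" for a using that B(2) unfolding twin_class_def by blast
  then have twin: "twin_set (F B)" unfolding twin_set_def by metis
  obtain c where c: "c \<in> F B" using F_in[OF B(1)] by blast
  have "N c = N v" by (rule twins[OF c])
  have "A \<subseteq> N x \<longleftrightarrow> A \<subseteq> N (preimage_point v)" if "A \<in> K" for A
    by (simp only: \<open>N c = N v\<close> subset_nbhd_iff[OF B(1) twin x c that] subset_nbhd_preimage_point_iff[OF v that])
  moreover have xV: "x \<in> V" using x B(1) by blast
  ultimately have "N x = N (preimage_point v)"
    by (intro nbhd_eqI preimage_point_in[OF v])
  with xV show "x \<in> twin_class (preimage_point v)" unfolding twin_class_def by blast
qed

lemma nbhd_preimage_point_eq_iff: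
  assumes u: "u \<in> V" and v: "v \<in> V"
  shows "N (preimage_point u) = N (preimage_point v) \<longleftrightarrow> N u = N v"
proof
  assume eq: "N (preimage_point u) = N (preimage_point v)"
  show "N u = N v"
  proof (rule nbhd_eqI[OF u v])
    fix A assume "A \<in> K"
    then obtain B where B: "B \<in> K" "F B = A" by (rule F_surj)
    show "A \<subseteq> N u \<longleftrightarrow> A \<subseteq> N v"
      unfolding B(2)[symmetric]
      by (simp only: eq subset_nbhd_preimage_point_iff[OF u B(1), symmetric]
          subset_nbhd_preimage_point_iff[OF v B(1), symmetric])
  qed
next
  assume eq: "N u = N v"
  show "N (preimage_point u) = N (preimage_point v)"
  proof (rule nbhd_eqI[OF preimage_point_in[OF u] preimage_point_in[OF v]])
    fix A assume A: "A \<in> K"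
    show "A \<subseteq> N (preimage_point u) \<longleftrightarrow> A \<subseteq> N (preimage_point v)"
      by (simp only: eq subset_nbhd_preimage_point_iff[OF u A]
          subset_nbhd_preimage_point_iff[OF v A])
  qed
qed

text \<open>Membership in \<open>N (preimage_point v)\<close> is the same for all twins of a vertex, so
  \<open>preimage_point u\<close> may be replaced by the whole set that \<open>F\<close> maps to \<open>{u}\<close>.\<close>

lemma preimage_point_nbhd_iff:
  assumes u: "u \<in> V" and v: "v \<in> V"
  shows "preimage_point u \<in> N (preimage_point v) \<longleftrightarrow> u \<in> N v"
  using u
proof (rule preimage_point)
  fix B assume B: "B \<in> K" "F B = {u}" "preimage_point u \<in> B" "twin_set B"
  have "b \<in> N x \<longleftrightarrow> preimage_point u \<in> N x" if "b \<in> B" for b x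
    using B(3,4) that nbhd_commute[of _ x] unfolding twin_set_def by metis
  then have "B \<subseteq> N (preimage_point v) \<longleftrightarrow> preimage_point u \<in> N (preimage_point v)"
    using B(3) by blast
  then show ?thesis using subset_nbhd_preimage_point_iff[OF v B(1)] B(2) by (simp del: in_mcball)
qed

lemma finite_twin_class: "finite (twin_class v)"
proof -
  have "twin_class v \<subseteq> N v" unfolding twin_class_def using nbhd_refl by blast
  then show ?thesis using finite_nbhd finite_subset by blast
qed

text \<open>The nonempty subsets of \<open>twin_class v\<close> have their \<open>F\<close>-preimages among those of
  \<open>twin_class (preimage_point v)\<close>.\<close>

lemma card_twin_class_le:
  assumes v: "v \<in> V"
  shows "card (twin_class v) \<le> card (twin_class (preimage_point v))"
proof -
  let ?P = "Pow (twin_class v) - {{}}" and ?Q = "Pow (twin_class (preimage_point v)) - {{}}"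
  have "?P \<subseteq> F ` ?Q"
  proof
    fix A assume A: "A \<in> ?P"
    then have "A \<subseteq> V" unfolding twin_class_def by blast
    moreover have "finite A" using A finite_twin_class[of v] finite_subset by blast
    ultimately have "A \<in> K" using A by blast
    then obtain B where B: "B \<in> K" "F B = A" by (rule F_surj)
    have "B \<subseteq> twin_class (preimage_point v)"
      by (rule preimage_in_twin_class[OF v B(1)]) (use A B(2) in simp)
    then show "A \<in> F ` ?Q" using B by auto
  qed
  then have "card ?P \<le> card ?Q" by (intro surj_card_le) (simp_all add: finite_twin_class)
  then have "2 ^ card (twin_class v) - 1 \<le> (2::nat) ^ card (twin_class (preimage_point v)) - 1"
    by (simp add: card_Diff_singleton finite_twin_class card_Pow)
  then have "2 ^ card (twin_class v) \<le> (2::nat) ^ card (twin_class (preimage_point v))"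
    by (metis diff_le_mono2 le_diff_iff one_le_numeral one_le_power)
  then show ?thesis by simp
qed

text \<open>Since \<open>preimage_point\<close> need not be injective, it is corrected on each class \<open>C\<close> of twins by an
  injection \<open>\<beta> C\<close> into the corresponding class, and \<open>g v = \<beta> (twin_class v) v\<close>. This keeps all
  neighbourhoods and makes \<open>g\<close> injective, because distinct classes go to distinct classes. As \<open>N v\<close>
  and \<open>N (g v)\<close> have \<open>k + 1\<close> elements each, the inclusion \<open>g ` N v \<subseteq> N (g v)\<close> is an equality, and
  \<open>g\<close> is onto by connectedness.\<close>

lemma ex_automorphism:
  obtains g where "bij_betw g V V" "\<And>v. v \<in> V \<Longrightarrow> g ` N v = N (g v)"
    "\<And>v. v \<in> V \<Longrightarrow> N (g v) = N (preimage_point v)"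
proof -
  let ?h = preimage_point
  have "\<exists>\<beta>. \<forall>v\<in>V. twin_class v = C \<longrightarrow> \<beta> ` C \<subseteq> twin_class (?h v) \<and> inj_on \<beta> C" for C
  proof (cases "\<exists>v\<in>V. twin_class v = C")
    case True
    then obtain v where v: "v \<in> V" "twin_class v = C" by blast
    obtain \<beta> where \<beta>: "\<beta> ` C \<subseteq> twin_class (?h v)" "inj_on \<beta> C"
      using card_le_inj[OF finite_twin_class finite_twin_class card_twin_class_le[OF v(1)]] v(2)
      by blast
    have "twin_class (?h u) = twin_class (?h v)" if "u \<in> V" "twin_class u = C" for u
    proof -
      have "u \<in> twin_class v" using that v unfolding twin_class_def by blast
      then have "N u = N v" unfolding twin_class_def by blast
      then have "N (?h u) = N (?h v)" using nbhd_preimage_point_eq_iff[OF that(1) v(1)] by blast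
      then show ?thesis unfolding twin_class_def by (simp only:)
    qed
    then show ?thesis using \<beta> by (intro exI[of _ \<beta>]) auto
  qed blast
  then obtain \<beta> where \<beta>: "\<And>v. v \<in> V \<Longrightarrow> \<beta> (twin_class v) ` twin_class v \<subseteq> twin_class (?h v)"
    "\<And>v. v \<in> V \<Longrightarrow> inj_on (\<beta> (twin_class v)) (twin_class v)"
    by metis
  define g where "g v = \<beta> (twin_class v) v" for v
  have self: "v \<in> twin_class v" if "v \<in> V" for v using that unfolding twin_class_def by blast
  have g: "g v \<in> V" "N (g v) = N (?h v)" if "v \<in> V" for v
    using \<beta>(1)[OF that] self[OF that] unfolding g_def twin_class_def by blast+
  have inj: "inj_on g V"
  proof
    fix u v assume uv: "u \<in> V" "v \<in> V" "g u = g v"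
    then have "N (?h u) = N (?h v)" using g by metis
    then have "N u = N v" using nbhd_preimage_point_eq_iff uv by blast
    then have *: "twin_class u = twin_class v" unfolding twin_class_def by simp
    then have "\<beta> (twin_class v) u = \<beta> (twin_class v) v" using uv(3) unfolding g_def by simp
    then show "u = v" using inj_onD[OF \<beta>(2)[OF uv(2)]] self uv * by blast
  qed
  have nbhd: "g ` N v = N (g v)" if v: "v \<in> V" for v
  proof (rule card_subset_eq[OF finite_nbhd])
    show "g ` N v \<subseteq> N (g v)"
    proof clarify
      fix u assume u: "u \<in> N v"
      then have uV: "u \<in> V" by simp
      have "?h u \<in> N (g v)" using preimage_point_nbhd_iff[OF uV v] u g[OF v] by simp
      then have "g v \<in> N (g u)" using nbhd_commute g[OF uV] by blast
      then show "g u \<in> N (g v)" using nbhd_commute by blast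
    qed
    have "inj_on g (N v)" using inj by (rule inj_on_subset) auto
    then show "card (g ` N v) = card (N (g v))" using card_image card_nbhd v g by metis
  qed
  have "g ` V = V"
  proof (cases "V = {}")
    case False
    then obtain x where "x \<in> V" by blast
    then show ?thesis
    proof (intro nbhd_closed_is_everything[of "g x"])
      fix y assume "y \<in> g ` V"
      then obtain v where "v \<in> V" "y = g v" by blast
      then have "N y = g ` N v" using nbhd by simp
      then show "N y \<subseteq> g ` V" by auto
    qed (use g in auto)
  qed simp
  then show ?thesis using that[of g] inj g nbhd unfolding bij_betw_def by blast
qed

text \<open>The automorphism \<open>g\<close> moves the problem to \<open>F' = F \<circ> (`) g\<close>, which maps a set \<open>B\<close> of twins of
  \<open>v\<close> to \<open>{v}\<close>. A set \<open>S\<close> lies in the ball of radius \<open>n \<ge> 1\<close> around \<open>v\<close> if and only if it is within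
  distance \<open>n\<close> of \<open>{v}\<close>, or equivalently of \<open>B\<close>. So \<open>F'\<close> preserves the finite set of the nonempty
  subsets of this ball, where it reflects closeness.\<close>

lemma near_reflect:
  assumes A: "A \<in> K" "A' \<in> K" and FA: "near d s (F A) (F A')"
  shows "near d s A A'"
proof -
  obtain g where g: "bij_betw g V V" "\<And>v. v \<in> V \<Longrightarrow> g ` N v = N (g v)"
    "\<And>v. v \<in> V \<Longrightarrow> N (g v) = N (preimage_point v)"
    using ex_automorphism by blast
  have iso: "d (g u) (g v) = d u v" if "u \<in> V" "v \<in> V" for u v
    using nbhd_isomorphism_is_isometry[OF g(1,2)] that by blast
  have gK: "bij_betw ((`) g) K K"
  proof -
    have inj: "inj_on g V" and surj: "g ` V = V" using g(1) unfolding bij_betw_def by auto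
    have "inj_on ((`) g) K" using inj by (auto simp: inj_on_def inj_on_image_eq_iff)
    moreover have "(`) g ` K = K"
    proof
      show "(`) g ` K \<subseteq> K" using surj by auto
      show "K \<subseteq> (`) g ` K"
      proof
        fix B assume B: "B \<in> K"
        then obtain C where C: "C \<subseteq> V" "finite C" "B = g ` C"
          using finite_subset_image[of B g V] surj by auto
        then show "B \<in> (`) g ` K" using B by auto
      qed
    qed
    ultimately show ?thesis unfolding bij_betw_def by blast
  qed
  have near_g: "near d s (g ` B) (g ` C) \<longleftrightarrow> near d s B C" if "B \<in> K" "C \<in> K" for s B C
    using that iso unfolding near_def by (simp add: subset_iff)
  define F' where "F' B = F (g ` B)" for B
  have F': "bij_betw F' K K"
    using bij_betw_trans[OF gK bij] unfolding F'_def comp_def .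
  have near': "near d s (F' B) (F' C)" if "B \<in> K" "C \<in> K" "near d s B C" for s B C
    unfolding F'_def
    by (intro near_image bspec[OF bij_betwE[OF gK]] that(1,2)) (simp only: near_g that)
  obtain v where v: "v \<in> V" using A by blast
  obtain C where C: "C \<in> K" "F C = {v}" "preimage_point v \<in> C" "twin_set C"
    by (rule preimage_point[OF v])
  have g_surj: "\<exists>T\<in>K. g ` T = S" if "S \<in> K" for S
  proof -
    have "S \<in> (`) g ` K" using that bij_betw_imp_surj_on[OF gK] by (simp only:)
    then obtain T where "S = g ` T" "T \<in> K" by (rule imageE)
    then show ?thesis by (intro bexI[of _ T]) simp_all
  qed
  obtain B where B: "B \<in> K" "g ` B = C"
    using g_surj[OF C(1)] by (elim bexE)
  have B_twin: "N b = N v" if b: "b \<in> B" for b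
  proof -
    have "b \<in> V" using b B by blast
    have "N (g b) = N (preimage_point v)"
      using C(4)[unfolded twin_set_def] imageI[OF b, of g] C(3) unfolding B(2) by blast
    then show ?thesis
      using nbhd_preimage_point_eq_iff[OF \<open>b \<in> V\<close> v] g(3)[OF \<open>b \<in> V\<close>] by blast
  qed
  have bounded: "F' S \<subseteq> mcball v (real n)" if S: "S \<in> K" "S \<subseteq> mcball v (real n)" and n: "n \<ge> 1" for S n
  proof -
    have "mcball b (real n) = mcball v (real n)" if "b \<in> B" for b
      using twins_mcball[OF _ v B_twin n] that B by blast
    then have "d b x \<le> real n" if "b \<in> B" "x \<in> S" for b x
      using that S by fastforce
    moreover from this have "d x b \<le> real n" if "b \<in> B" "x \<in> S" for b x
      using that commute[of x b] by simp
    moreover have "B \<noteq> {}" "S \<noteq> {}" using B(1) S(1) by simp_all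
    ultimately have "near d (real n) B S"
      unfolding near_def by blast
    then have "near d (real n) {v} (F' S)"
      using near'[OF B(1) S(1)] B(2) C(2) unfolding F'_def by simp
    moreover have "F' S \<in> K" using bij_betwE[OF F'] S(1) by (rule bspec)
    ultimately show ?thesis using v unfolding near_def by (auto simp: commute)
  qed
  \<comment> \<open>Two given sets lie in a common ball around \<open>v\<close>; radius 0 is excluded by \<open>twins_mcball\<close>.\<close>
  obtain B0 B1 where B01: "B0 \<in> K" "B1 \<in> K" "g ` B0 = A" "g ` B1 = A'"
    using g_surj[OF A(1)] g_surj[OF A(2)] by (elim bexE)
  obtain n where n: "n \<ge> 1" "B0 \<union> B1 \<subseteq> mcball v (real n)"
  proof -
    have "finite (B0 \<union> B1)" using B01 by blast
    then have fin: "finite ((d v) ` (B0 \<union> B1))" by blast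
    obtain n where n: "real n \<ge> Max (insert 1 (d v ` (B0 \<union> B1)))" using real_arch_simple by blast
    then have *: "n \<ge> 1" "\<And>x. x \<in> B0 \<union> B1 \<Longrightarrow> d v x \<le> real n" using fin by auto
    then have "B0 \<union> B1 \<subseteq> mcball v (real n)" using B01 v by auto
    then show ?thesis using that * by blast
  qed
  define X where "X = Pow (mcball v (real n)) - {{}}"
  have X: "X \<subseteq> K" "finite X"
    unfolding X_def using finite_mcball finite_subset by (auto intro: finite_subset)
  have F'X: "F' S \<in> X" if "S \<in> X" for S
  proof -
    have S: "S \<in> K" using that X(1) by (rule subsetD[rotated])
    then have "F' S \<in> K" by (rule bspec[OF bij_betwE[OF F']])
    then show ?thesis using bounded[OF S _ n(1)] that unfolding X_def by simp
  qed
  have BX: "B0 \<in> X" "B1 \<in> X" using n(2) B01 unfolding X_def by auto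
  have "near d s B0 B1"
  proof (rule finite_relation_reflected[OF X(2) _ _ _ BX])
    show "inj_on F' X" by (rule inj_on_subset[OF bij_betw_imp_inj_on[OF F'] X(1)])
    show "F' ` X \<subseteq> X" using F'X by (rule image_subsetI)
    show "near d s (F' S) (F' T)" if "S \<in> X" "T \<in> X" "near d s S T" for S T
      using near'[OF subsetD[OF X(1) that(1)] subsetD[OF X(1) that(2)] that(3)] .
    show "near d s (F' B0) (F' B1)" using FA unfolding F'_def B01(3,4) .
  qed
  then show ?thesis using near_g[OF B01(1,2)] unfolding B01(3,4) by blast
qed

end

lemma (in regular_graph_metric) plastic_finite_subsets: "plastic K (hausdorff_dist d)"
  unfolding plastic_def
proof (intro allI impI)
  fix F assume F: "bij_betw F K K \<and> nonexpansive_on K (hausdorff_dist d) F"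
  then have bij: "bij_betw F K K" by (rule conjunct1)
  have FK: "F A \<in> K" if "A \<in> K" for A
    using bspec[OF bij_betwE[OF bij] that] .
  have hd: "hausdorff_dist d A B \<le> r \<longleftrightarrow> near d r A B" if "A \<in> K" "B \<in> K" for A B r
    using that by (intro hausdorff_dist_le_iff_near) simp_all
  have nonexp: "hausdorff_dist d (F A) (F B) \<le> hausdorff_dist d A B"
    if "A \<in> K" "B \<in> K" for A B
    using bspec[OF bspec[OF conjunct2[OF F, unfolded nonexpansive_on_def] that(1)] that(2)] .
  interpret hyperspace_bijection V d k F
  proof
    fix A B r assume AB: "A \<in> K" "B \<in> K" "near d r A B"
    have "hausdorff_dist d A B \<le> r" using AB(3) by (simp only: hd[OF AB(1,2)])
    then have "hausdorff_dist d (F A) (F B) \<le> r"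
      by (rule order_trans[OF nonexp[OF AB(1,2)]])
    then show "near d r (F A) (F B)" by (simp only: hd[OF FK[OF AB(1)] FK[OF AB(2)]])
  qed (rule bij)
  show "isometry_on K (hausdorff_dist d) F"
    unfolding isometry_on_def
  proof (intro ballI antisym)
    fix A B assume AB: "A \<in> K" "B \<in> K"
    show "hausdorff_dist d (F A) (F B) \<le> hausdorff_dist d A B"
      by (rule nonexp[OF AB])
    have "near d (hausdorff_dist d (F A) (F B)) (F A) (F B)"
      by (simp only: hd[OF FK[OF AB(1)] FK[OF AB(2)], symmetric] order_refl)
    then have "near d (hausdorff_dist d (F A) (F B)) A B" by (rule near_reflect[OF AB])
    then show "hausdorff_dist d A B \<le> hausdorff_dist d (F A) (F B)"
      by (simp only: hd[OF AB])
  qed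
qed

section \<open>Regular graphs\<close>

lemma (in sym_digraph) path_dist_geodesic_step:
  assumes conn: "Digraph_Component.connected G" and uv: "u \<in> verts G" "v \<in> verts G"
    and le: "path_dist G u v \<le> real (Suc n)"
  shows "\<exists>w\<in>verts G. path_dist G u w \<le> 1 \<and> path_dist G w v \<le> real n"
proof -
  obtain p where p: "awalk u p v" "path_dist G u v = length p"
    using path_dist_attained connected_reachable[OF conn uv] by blast
  show ?thesis
  proof (cases p)
    case Nil
    then have "u = v" using p by (simp add: awalk_Nil_iff)
    moreover have "awalk v [] v" using uv by (simp add: awalk_Nil_iff)
    from path_dist_le[OF this] have "path_dist G v v \<le> 0" by simp
    ultimately show ?thesis using uv by (intro bexI[of _ v]) auto
  next
    case (Cons e q)
    then have e: "e \<in> arcs G" "tail G e = u" "awalk (head G e) q v"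
      using p(1) by (auto simp: awalk_Cons_iff)
    have "awalk u [e] (head G e)" using e by (auto simp: awalk_Cons_iff awalk_Nil_iff)
    from path_dist_le[OF this] have "path_dist G u (head G e) \<le> 1" by simp
    moreover have "path_dist G (head G e) v \<le> real n"
      using path_dist_le[OF e(3)] p(2) le Cons by simp
    ultimately show ?thesis using e(1) by (intro bexI[of _ "head G e"]) auto
  qed
qed

lemma (in simple_graph) card_path_dist_le_1:
  assumes conn: "Digraph_Component.connected G" and v: "v \<in> verts G"
    and fin: "finite (out_arcs G v)"
  shows "card {w\<in>verts G. path_dist G v w \<le> 1} = Suc (out_degree G v)"
proof -
  have "{w\<in>verts G. path_dist G v w \<le> 1} = insert v (head G ` out_arcs G v)" (is "?L = ?R")
  proof
    show "?L \<subseteq> ?R"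
    proof
      fix w assume w: "w \<in> ?L"
      then obtain p where p: "awalk v p w" "path_dist G v w = length p"
        using path_dist_attained connected_reachable[OF conn v] by blast
      with w have "p = [] \<or> (\<exists>e. p = [e])" by (cases p) auto
      then show "w \<in> ?R"
        using p(1) by (auto simp: awalk_Cons_iff awalk_Nil_iff)
    qed
    have "awalk v [] v" using v by (simp add: awalk_Nil_iff)
    from path_dist_le[OF this] have "v \<in> ?L" using v by simp
    moreover have "head G e \<in> ?L" if "e \<in> out_arcs G v" for e
    proof -
      have "awalk v [e] (head G e)" using that by (auto simp: awalk_Cons_iff awalk_Nil_iff)
      from path_dist_le[OF this] show ?thesis using that by auto
    qed
    ultimately show "?R \<subseteq> ?L" by blast
  qed
  moreover have "inj_on (head G) (out_arcs G v)"
    using no_multi_arcs by (intro inj_onI) (auto simp: arc_to_ends_def)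
  moreover have "v \<notin> head G ` out_arcs G v" using no_loops by fastforce
  ultimately show ?thesis
    using fin by (simp add: card_image out_degree_def)
qed

theorem theorem4p12:
  fixes G :: "('a, 'b) pre_digraph" and k :: nat
  assumes "simple_graph G"
    and "Digraph_Component.connected G"
    and "locally_finite G"
    and "regular_graph k G"
  shows "plastic (hyperspace (verts G) (path_dist G)) (hausdorff_dist (path_dist G))"
proof -
  interpret simple_graph G by fact
  interpret M: Metric_space "verts G" "path_dist G"
    by (rule Metric_space_path_dist[OF assms(2)])
  interpret R: regular_graph_metric "verts G" "path_dist G" k
  proof
    fix v assume v: "v \<in> verts G"
    then have "M.mcball v 1 = {w\<in>verts G. path_dist G v w \<le> 1}" by auto
    then show "card (M.mcball v 1) = Suc k"
      using card_path_dist_le_1[OF assms(2) v] assms(4) v unfolding regular_graph_def by simp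
  qed (use path_dist_geodesic_step[OF assms(2)] in \<open>auto simp: path_dist_def\<close>)
  show ?thesis
    unfolding hyperspace_path_dist[OF assms(2)] by (rule R.plastic_finite_subsets)
qed

end
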